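(* Let $n\ge 5$ and let $\Gamma=(G,\sigma)$ be an unbalanced signed graph of order $n$. If $\lambda_1(\Gamma)\ge \lambda_1(\Gamma_1)$, where $\Gamma_1$ is the signed graph on $n$ vertices defined in the context, then $\Gamma$ contains a negative $C_4$ (a negative cycle of length $4$) as a subgraph, unless $\Gamma$ is switching equivalent to $\Gamma_1$.
   Context: All graphs are finite and simple. A signed graph $\Gamma=(G,\sigma)$ consists of a graph $G=(V(G),E(G))$ and a sign function $\sigma:E(G)\to\{-1,1\}$; its order is $|V(G)|$. An edge $e$ is positive if $\sigma(e)=1$ and negative if $\sigma(e)=-1$. A cycle in $\Gamma$ (a cycle of $G$, with edge signs inherited from $\sigma$) is positive if it has an even number of negative edges and negative if it has an odd number of negative edges. $\Gamma$ is balanced if all its cycles are positive, and unbalanced otherwise. "Contains as a subgraph" refers to not necessarily induced subgraphs. The adjacency matrix $A(\Gamma)=(a^\sigma_{ij})$ has $a^\sigma_{ij}=\sigma(v_iv_j)$ if $v_i$ and $v_j$ are adjacent in $G$, and $a^\sigma_{ij}=0$ otherwise. $\lambda_1(\Gamma)$ denotes the largest eigenvalue of $A(\Gamma)$ (the index of $\Gamma$). For $U\subset V(G)$, the switching operation with respect to $U$ changes the sign of every edge between $U$ and $V(G)\setminus U$. Two signed graphs are switching equivalent if one is obtained from the other by finitely many switching operations. Signed graphs are considered up to (sign-preserving) isomorphism, so "$\Gamma$ is switching equivalent to $\Gamma_1$" means that $\Gamma$ is switching equivalent to a signed graph isomorphic to $\Gamma_1$. Definition of $\Gamma_1$ (for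 $n\ge5$): its vertices are $v_1,\dots,v_n$. The vertices $v_3,v_4,\dots,v_n$ induce a complete graph $K_{n-2}$ with all edges positive; the edges $v_1v_3$ and $v_2v_3$ are positive; the edge $v_1v_2$ is negative; there are no other edges. *)

theory Defs
  imports "Jordan_Normal_Form.Spectral_Radius"
begin

text \<open>A finite simple graph with signs on its edges. Edges are two-element sets of vertices; the
  values of \<open>edge_sign\<close> outside \<open>edges\<close> are irrelevant.\<close>

record 'a signed_graph =
  verts :: "'a set"
  edges :: "'a set set"
  edge_sign :: "'a set \<Rightarrow> int"

definition signed_graph :: "'a signed_graph \<Rightarrow> bool" where
  "signed_graph \<Gamma> \<longleftrightarrow>
     finite (verts \<Gamma>) \<and>
     (\<forall>e\<in>edges \<Gamma>. e \<subseteq> verts \<Gamma> \<and> card e = 2) \<and>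
     (\<forall>e\<in>edges \<Gamma>. edge_sign \<Gamma> e \<in> {-1, 1})"

definition cycle_edges :: "'a list \<Rightarrow> 'a set set" where
  "cycle_edges c = {{c ! i, c ! (Suc i mod length c)} | i. i < length c}"

definition is_cycle :: "'a signed_graph \<Rightarrow> 'a list \<Rightarrow> bool" where
  "is_cycle \<Gamma> c \<longleftrightarrow>
     3 \<le> length c \<and> distinct c \<and> set c \<subseteq> verts \<Gamma> \<and> cycle_edges c \<subseteq> edges \<Gamma>"

definition negative_cycle :: "'a signed_graph \<Rightarrow> 'a list \<Rightarrow> bool" where
  "negative_cycle \<Gamma> c \<longleftrightarrow>
     is_cycle \<Gamma> c \<and> odd (card {e \<in> cycle_edges c. edge_sign \<Gamma> e = -1})"

definition positive_cycle :: "'a signed_graph \<Rightarrow> 'a list \<Rightarrow> bool" where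
  "positive_cycle \<Gamma> c \<longleftrightarrow>
     is_cycle \<Gamma> c \<and> even (card {e \<in> cycle_edges c. edge_sign \<Gamma> e = -1})"

definition balanced :: "'a signed_graph \<Rightarrow> bool" where
  "balanced \<Gamma> \<longleftrightarrow> (\<forall>c. is_cycle \<Gamma> c \<longrightarrow> positive_cycle \<Gamma> c)"

definition contains_negative_C4 :: "'a signed_graph \<Rightarrow> bool" where
  "contains_negative_C4 \<Gamma> \<longleftrightarrow> (\<exists>c. negative_cycle \<Gamma> c \<and> length c = 4)"

definition adjacency_matrix :: "'a signed_graph \<Rightarrow> 'a list \<Rightarrow> real mat" where
  "adjacency_matrix \<Gamma> vs = mat (length vs) (length vs)
     (\<lambda>(i, j). if {vs ! i, vs ! j} \<in> edges \<Gamma> then of_int (edge_sign \<Gamma> {vs ! i, vs ! j}) else 0)"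

text \<open>The adjacency matrix is taken with respect to an ordering \<open>vs\<close> of the vertices. Its
  eigenvalues do not depend on that ordering (\<open>graph_eigenvalues_eq\<close>), and they form a nonempty
  finite set (\<open>graph_eigenvalues_nonempty\<close>, \<open>finite_graph_eigenvalues\<close>), so that the maximum in
  \<open>index\<close> is meaningful.\<close>

definition graph_eigenvalues :: "'a signed_graph \<Rightarrow> real set" where
  "graph_eigenvalues \<Gamma> =
     {k. \<exists>vs. distinct vs \<and> set vs = verts \<Gamma> \<and> eigenvalue (adjacency_matrix \<Gamma> vs) k}"

definition index :: "'a signed_graph \<Rightarrow> real" where
  "index \<Gamma> = Max (graph_eigenvalues \<Gamma>)"

definition switch :: "'a set \<Rightarrow> 'a signed_graph \<Rightarrow> 'a signed_graph" where
  "switch U \<Gamma> = \<Gamma>\<lparr>edge_sign := (\<lambda>e.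
     if e \<in> edges \<Gamma> \<and> e \<inter> U \<noteq> {} \<and> e \<inter> (verts \<Gamma> - U) \<noteq> {}
     then - edge_sign \<Gamma> e else edge_sign \<Gamma> e)\<rparr>"

definition switching_equivalent :: "'a signed_graph \<Rightarrow> 'a signed_graph \<Rightarrow> bool" where
  "switching_equivalent = (\<lambda>\<Gamma> \<Delta>. \<exists>U \<subseteq> verts \<Gamma>. \<Delta> = switch U \<Gamma>)\<^sup>*\<^sup>*"

definition isomorphic :: "'a signed_graph \<Rightarrow> 'b signed_graph \<Rightarrow> bool" where
  "isomorphic \<Gamma> \<Delta> \<longleftrightarrow>
     (\<exists>f. bij_betw f (verts \<Gamma>) (verts \<Delta>) \<and>
          edges \<Delta> = (\<lambda>e. f ` e) ` edges \<Gamma> \<and>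
          (\<forall>e\<in>edges \<Gamma>. edge_sign \<Delta> (f ` e) = edge_sign \<Gamma> e))"

definition switching_equivalent_upto_iso :: "'a signed_graph \<Rightarrow> 'b signed_graph \<Rightarrow> bool" where
  "switching_equivalent_upto_iso \<Gamma> \<Delta> \<longleftrightarrow>
     (\<exists>\<Gamma>'. switching_equivalent \<Gamma> \<Gamma>' \<and> isomorphic \<Gamma>' \<Delta>)"

definition Gamma1 :: "nat \<Rightarrow> nat signed_graph" where
  "Gamma1 n = \<lparr>
     verts = {1..n},
     edges = {{i, j} | i j. 3 \<le> i \<and> i < j \<and> j \<le> n} \<union> {{1, 3}, {2, 3}, {1, 2}},
     edge_sign = (\<lambda>e. if e = {1, 2} then -1 else 1)\<rparr>"


lemma eigenvalue_adjacency_matrix_iff: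
  assumes vs: "distinct vs" "set vs = verts \<Gamma>"
  shows "eigenvalue (adjacency_matrix \<Gamma> vs) k \<longleftrightarrow>
    (\<exists>x :: 'a \<Rightarrow> real. (\<exists>v\<in>verts \<Gamma>. x v \<noteq> 0) \<and> (\<forall>u\<in>verts \<Gamma>.
       (\<Sum>v\<in>verts \<Gamma>. (if {u, v} \<in> edges \<Gamma> then of_int (edge_sign \<Gamma> {u, v}) else 0) * x v) = k * x u))"
    (is "?L \<longleftrightarrow> (\<exists>x. ?R x)")
proof -
  let ?n = "length vs"
  let ?a = "\<lambda>u v. (if {u, v} \<in> edges \<Gamma> then real_of_int (edge_sign \<Gamma> {u, v}) else 0)"
  have bij: "bij_betw ((!) vs) {0..<?n} (verts \<Gamma>)"
    by (rule bij_betw_nth[OF vs(1)]) (use vs(2) in auto)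
  have entry: "(adjacency_matrix \<Gamma> vs *\<^sub>v w) $ i = (\<Sum>j = 0..<?n. ?a (vs ! i) (vs ! j) * w $ j)"
    if "i < ?n" "dim_vec w = ?n" for w i
    using that by (auto simp: adjacency_matrix_def scalar_prod_def intro!: sum.cong)
  have reidx: "(\<Sum>v\<in>verts \<Gamma>. ?a u v * x v) = (\<Sum>j = 0..<?n. ?a u (vs ! j) * x (vs ! j))" for u x
    by (rule sum.reindex_bij_betw[OF bij, symmetric])
  show ?thesis
  proof
    assume ?L
    then obtain w where w: "eigenvector (adjacency_matrix \<Gamma> vs) w k"
      unfolding eigenvalue_def by blast
    have "dim_row (adjacency_matrix \<Gamma> vs) = ?n" by (simp add: adjacency_matrix_def)
    with w have "dim_vec w = ?n" "w \<noteq> 0\<^sub>v ?n"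
      and eq: "adjacency_matrix \<Gamma> vs *\<^sub>v w = k \<cdot>\<^sub>v w"
      unfolding eigenvector_def by auto
    then obtain i where i: "i < ?n" "w $ i \<noteq> 0"
      by (metis eq_vecI index_zero_vec(1,2))
    define x where "x v = w $ (inv_into {0..<?n} ((!) vs) v)" for v
    have x: "x (vs ! j) = w $ j" if "j < ?n" for j
      using that bij_betw_inv_into_left[OF bij, of j] by (simp add: x_def)
    have "?R x"
    proof
      show "\<exists>v\<in>verts \<Gamma>. x v \<noteq> 0"
        using i x vs(2) by (intro bexI[of _ "vs ! i"]) auto
      show "\<forall>u\<in>verts \<Gamma>. (\<Sum>v\<in>verts \<Gamma>. ?a u v * x v) = k * x u"
      proof
        fix u assume "u \<in> verts \<Gamma>"
        then obtain i where i: "i < ?n" "u = vs ! i" using vs(2) by (metis in_set_conv_nth)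
        have "(\<Sum>v\<in>verts \<Gamma>. ?a u v * x v) = (adjacency_matrix \<Gamma> vs *\<^sub>v w) $ i"
          unfolding reidx entry[OF i(1) \<open>dim_vec w = ?n\<close>] using i x by (auto intro!: sum.cong)
        also have "\<dots> = k * x u" using i x \<open>dim_vec w = ?n\<close> by (simp add: eq)
        finally show "(\<Sum>v\<in>verts \<Gamma>. ?a u v * x v) = k * x u" .
      qed
    qed
    then show "\<exists>x. ?R x" by (rule exI[of ?R])
  next
    assume "\<exists>x. ?R x"
    then obtain x v where v: "v \<in> verts \<Gamma>" "x v \<noteq> 0"
      and x: "\<And>u. u \<in> verts \<Gamma> \<Longrightarrow> (\<Sum>v\<in>verts \<Gamma>. ?a u v * x v) = k * x u" by blast
    obtain i where i: "i < ?n" "v = vs ! i" using v vs(2) by (metis in_set_conv_nth)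
    define w where "w = vec ?n (\<lambda>i. x (vs ! i))"
    have "w $ i \<noteq> 0" using v i by (simp add: w_def)
    then have "w \<noteq> 0\<^sub>v ?n" using i by auto
    moreover have "adjacency_matrix \<Gamma> vs *\<^sub>v w = k \<cdot>\<^sub>v w"
    proof (rule eq_vecI)
      fix j assume "j < dim_vec (k \<cdot>\<^sub>v w)"
      then have j: "j < ?n" by (simp add: w_def)
      have "(adjacency_matrix \<Gamma> vs *\<^sub>v w) $ j = (\<Sum>l = 0..<?n. ?a (vs ! j) (vs ! l) * x (vs ! l))"
        by (subst entry[OF j]) (auto simp: w_def intro!: sum.cong)
      also have "\<dots> = k * x (vs ! j)"
      proof -
        have "vs ! j \<in> verts \<Gamma>" using j vs(2) nth_mem by blast
        from x[OF this, unfolded reidx] show ?thesis .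
      qed
      finally show "(adjacency_matrix \<Gamma> vs *\<^sub>v w) $ j = (k \<cdot>\<^sub>v w) $ j" using j by (simp add: w_def)
    qed (simp add: adjacency_matrix_def w_def)
    ultimately show ?L
      unfolding eigenvalue_def eigenvector_def
      by (intro exI[of _ w]) (auto simp: adjacency_matrix_def w_def)
  qed
qed

lemma graph_eigenvalues_eq:
  assumes "distinct vs" "set vs = verts \<Gamma>"
  shows "graph_eigenvalues \<Gamma> = {k. eigenvalue (adjacency_matrix \<Gamma> vs) k}"
proof -
  have "eigenvalue (adjacency_matrix \<Gamma> ws) k \<longleftrightarrow> eigenvalue (adjacency_matrix \<Gamma> vs) k"
    if "distinct ws" "set ws = verts \<Gamma>" for ws k
    unfolding eigenvalue_adjacency_matrix_iff[OF that] eigenvalue_adjacency_matrix_iff[OF assms] ..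
  then show ?thesis
    using assms unfolding graph_eigenvalues_def by blast
qed

lemma finite_graph_eigenvalues:
  assumes "signed_graph \<Gamma>"
  shows "finite (graph_eigenvalues \<Gamma>)"
proof -
  obtain vs where vs: "distinct vs" "set vs = verts \<Gamma>"
    using assms finite_distinct_list unfolding signed_graph_def by metis
  have A: "adjacency_matrix \<Gamma> vs \<in> carrier_mat (length vs) (length vs)"
    by (simp add: adjacency_matrix_def)
  show ?thesis
    using card_finite_spectrum(1)[OF A] by (simp add: graph_eigenvalues_eq[OF vs] spectrum_def)
qed

lemma symmetric_real_eigenvalue:
  fixes A :: "real mat"
  assumes A: "A \<in> carrier_mat n n" and n: "n > 0"
    and sym: "\<And>i j. i < n \<Longrightarrow> j < n \<Longrightarrow> A $$ (i, j) = A $$ (j, i)"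
  shows "\<exists>k. eigenvalue A k"
proof -
  let ?B = "map_mat complex_of_real A"
  have B: "?B \<in> carrier_mat n n" using A by simp
  obtain z where z: "eigenvalue ?B z"
    using spectrum_non_empty[OF B n] by (auto simp: spectrum_def)
  then obtain w where ev: "eigenvector ?B w z"
    unfolding eigenvalue_def by blast
  have "dim_row ?B = n" using B by simp
  with ev have w: "dim_vec w = n" "w \<noteq> 0\<^sub>v n" and eq: "?B *\<^sub>v w = z \<cdot>\<^sub>v w"
    unfolding eigenvector_def by auto
  have row: "(\<Sum>j = 0..<n. complex_of_real (A $$ (i, j)) * w $ j) = z * w $ i" if "i < n" for i
  proof -
    have "(?B *\<^sub>v w) $ i = (\<Sum>j = 0..<n. complex_of_real (A $$ (i, j)) * w $ j)"
      using that A w by (auto simp: scalar_prod_def intro!: sum.cong)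
    then show ?thesis using eq that w by simp
  qed
  define S where "S = (\<Sum>i = 0..<n. \<Sum>j = 0..<n. cnj (w $ i) * (complex_of_real (A $$ (i, j)) * w $ j))"
  define N where "N = (\<Sum>i = 0..<n. (cmod (w $ i))\<^sup>2)"
  have S: "S = z * complex_of_real N"
  proof -
    have "S = (\<Sum>i = 0..<n. cnj (w $ i) * (z * w $ i))"
      unfolding S_def sum_distrib_left[symmetric] using row by (intro sum.cong) auto
    also have "\<dots> = z * (\<Sum>i = 0..<n. complex_of_real ((cmod (w $ i))\<^sup>2))"
      by (simp add: sum_distrib_left complex_norm_square[unfolded of_real_power] mult_ac)
    finally show ?thesis by (simp add: N_def)
  qed
  have "cnj S = (\<Sum>i = 0..<n. \<Sum>j = 0..<n. w $ i * (complex_of_real (A $$ (i, j)) * cnj (w $ j)))"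
    by (simp add: S_def)
  also have "\<dots> = (\<Sum>j = 0..<n. \<Sum>i = 0..<n. w $ i * (complex_of_real (A $$ (i, j)) * cnj (w $ j)))"
    by (rule sum.swap)
  also have "\<dots> = S"
    unfolding S_def using sym by (intro sum.cong) (auto simp: mult_ac)
  finally have cS: "cnj S = S" .
  obtain i where i: "i < n" "w $ i \<noteq> 0"
    using w by (metis eq_vecI index_zero_vec(1,2))
  have "N > 0"
    unfolding N_def using i by (intro sum_pos2[of _ i]) auto
  then have "cnj z = z" using cS unfolding S by simp
  then obtain k where k: "z = complex_of_real k"
    by (metis Reals_cases Reals_cnj_iff)
  have "poly (char_poly ?B) z = 0" using z B by (simp add: eigenvalue_root_char_poly)
  then have "poly (char_poly A) k = 0"
    unfolding k of_real_hom.char_poly_hom[OF A] by simp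
  then show ?thesis using A by (auto simp: eigenvalue_root_char_poly)
qed

lemma graph_eigenvalues_nonempty:
  assumes "signed_graph \<Gamma>" "verts \<Gamma> \<noteq> {}"
  shows "graph_eigenvalues \<Gamma> \<noteq> {}"
proof -
  obtain vs where vs: "distinct vs" "set vs = verts \<Gamma>"
    using assms finite_distinct_list unfolding signed_graph_def by metis
  have "\<exists>k. eigenvalue (adjacency_matrix \<Gamma> vs) k"
    by (rule symmetric_real_eigenvalue[of _ "length vs"])
      (use assms vs in \<open>auto simp: adjacency_matrix_def insert_commute\<close>)
  then show ?thesis by (simp add: graph_eigenvalues_eq[OF vs])
qed

end

theory Submission
  imports Defs
begin

text \<open>Let \<open>x\<close> be an eigenvector for the index \<open>k\<close> of \<open>\<Gamma>\<close>. Switching at the vertices where \<open>x\<close> is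
  negative makes \<open>x\<close> nonnegative; scale it so that its maximum is \<open>x\<^sub>u = 1\<close>. Since
  \<open>k > n - 3\<close>, the vertex \<open>u\<close> has at least \<open>n - 2\<close> positive neighbours. Let \<open>P\<close> be the set of them;
  without negative \<open>C\<^sub>4\<close>, two incident edges inside \<open>P\<close> have equal signs.

  If \<open>P\<close> contains a negative edge \<open>ab\<close>, then \<open>a\<close> and \<open>b\<close> have no positive neighbour in \<open>P\<close>. A vertex
  outside \<open>P \<union> {u}\<close> would then force \<open>(k - n + 4)(k + 1) < 4\<close>, which is too small. Without such a
  vertex the adjacency matrix of \<open>\<Gamma>\<close> is bounded entrywise by that of \<open>\<Gamma>\<^sub>1\<close>, and pairing \<open>x\<close> with a
  positive eigenvector of \<open>\<Gamma>\<^sub>1\<close> shows that the two matrices agree.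

  If \<open>P\<close> contains no negative edge, then \<open>\<Gamma>\<close> is balanced, unless there is a vertex \<open>z\<close> outside
  \<open>P \<union> {u}\<close> with \<open>uz\<close> negative and a nonempty set of positive neighbours in \<open>P\<close>. These neighbours are
  isolated inside \<open>P\<close>, which makes \<open>k\<close> too small.\<close>

section \<open>Adjacency entries and signs of cycles\<close>

definition adj :: "'a signed_graph \<Rightarrow> 'a \<Rightarrow> 'a \<Rightarrow> real" where
  "adj \<Gamma> u v = (if {u, v} \<in> edges \<Gamma> then of_int (edge_sign \<Gamma> {u, v}) else 0)"

lemma adj_commute: "adj \<Gamma> u v = adj \<Gamma> v u"
  by (simp add: adj_def insert_commute)

lemma adj_self: "signed_graph \<Gamma> \<Longrightarrow> adj \<Gamma> v v = 0"
  by (force simp: adj_def signed_graph_def)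

lemma adj_range: "signed_graph \<Gamma> \<Longrightarrow> adj \<Gamma> u v \<in> {-1, 0, 1}"
  by (auto simp: adj_def signed_graph_def)

lemma adj_eq_0_iff: "signed_graph \<Gamma> \<Longrightarrow> adj \<Gamma> u v = 0 \<longleftrightarrow> {u, v} \<notin> edges \<Gamma>"
  by (auto simp: adj_def signed_graph_def)

lemma signed_graph_edgeE:
  assumes "signed_graph \<Gamma>" "e \<in> edges \<Gamma>"
  obtains p q where "e = {p, q}" "p \<in> verts \<Gamma>" "q \<in> verts \<Gamma>"
proof -
  have "e \<subseteq> verts \<Gamma>" "card e = 2" using assms by (auto simp: signed_graph_def)
  then obtain p q where "e = {p, q}" by (meson card_2_iff)
  with \<open>e \<subseteq> verts \<Gamma>\<close> that show ?thesis by blast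
qed

lemma graph_eigenvalues_iff:
  assumes "finite (verts \<Gamma>)"
  shows "k \<in> graph_eigenvalues \<Gamma> \<longleftrightarrow>
    (\<exists>x. (\<exists>v\<in>verts \<Gamma>. x v \<noteq> 0) \<and> (\<forall>u\<in>verts \<Gamma>. (\<Sum>v\<in>verts \<Gamma>. adj \<Gamma> u v * x v) = k * x u))"
proof -
  obtain vs where vs: "distinct vs" "set vs = verts \<Gamma>"
    using assms finite_distinct_list by metis
  show ?thesis
    unfolding graph_eigenvalues_eq[OF vs] mem_Collect_eq eigenvalue_adjacency_matrix_iff[OF vs] adj_def ..
qed

text \<open>Turns the parity of the number of negative edges into a product, so that the sign of a
  cycle can be computed factor by factor.\<close>

lemma prod_edge_sign:
  assumes "signed_graph \<Gamma>" "finite E" "E \<subseteq> edges \<Gamma>"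
  shows "(\<Prod>e\<in>E. real_of_int (edge_sign \<Gamma> e)) = (-1) ^ card {e \<in> E. edge_sign \<Gamma> e = -1}"
proof -
  have "(\<Prod>e\<in>E. real_of_int (edge_sign \<Gamma> e)) = (\<Prod>e\<in>E. if edge_sign \<Gamma> e = -1 then -1 else 1)"
    using assms by (intro prod.cong) (auto simp: signed_graph_def)
  also have "\<dots> = (-1) ^ card {e \<in> E. edge_sign \<Gamma> e = -1}"
    using assms(2) by (subst prod.inter_filter[symmetric]) auto
  finally show ?thesis .
qed

lemma cycle_edges_image:
  "cycle_edges c = (\<lambda>i. {c ! i, c ! (Suc i mod length c)}) ` {..<length c}"
  unfolding cycle_edges_def by blast

text \<open>A nonzero product already makes all four pairs edges. As the vertices are distinct, so
  are these edges, and the product over the set of cycle edges has exactly these factors.\<close>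

lemma negative_C4_I:
  assumes \<Gamma>: "signed_graph \<Gamma>" and d: "distinct [p, q, r, t]"
    and neg: "adj \<Gamma> p q * adj \<Gamma> q r * adj \<Gamma> r t * adj \<Gamma> t p = -1"
  shows "contains_negative_C4 \<Gamma>"
proof -
  have "{..<length [p, q, r, t]} = {0, 1, 2, 3}" by auto
  then have ce: "cycle_edges [p, q, r, t] = {{p, q}, {q, r}, {r, t}, {t, p}}"
    unfolding cycle_edges_image by simp
  have "adj \<Gamma> p q \<noteq> 0" "adj \<Gamma> q r \<noteq> 0" "adj \<Gamma> r t \<noteq> 0" "adj \<Gamma> t p \<noteq> 0"
    using neg by auto
  then have e: "{p, q} \<in> edges \<Gamma>" "{q, r} \<in> edges \<Gamma>" "{r, t} \<in> edges \<Gamma>" "{t, p} \<in> edges \<Gamma>"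
    by (simp_all add: adj_def split: if_splits)
  then have sub: "cycle_edges [p, q, r, t] \<subseteq> edges \<Gamma>" by (simp add: ce)
  have "(\<Prod>e\<in>cycle_edges [p, q, r, t]. real_of_int (edge_sign \<Gamma> e)) = -1"
  proof -
    have "{p, q} \<notin> {{q, r}, {r, t}, {t, p}}" "{q, r} \<notin> {{r, t}, {t, p}}" "{r, t} \<noteq> {t, p}"
      using d by (auto simp: doubleton_eq_iff)
    then show ?thesis using neg e by (simp add: ce adj_def mult.assoc)
  qed
  then have "odd (card {e \<in> cycle_edges [p, q, r, t]. edge_sign \<Gamma> e = -1})"
    using prod_edge_sign[OF \<Gamma> _ sub] by (simp add: ce minus_one_power_iff split: if_splits)
  moreover have "{p, q, r, t} \<subseteq> verts \<Gamma>"
    using e \<Gamma> unfolding signed_graph_def by blast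
  ultimately have "negative_cycle \<Gamma> [p, q, r, t]"
    using d sub by (simp add: negative_cycle_def is_cycle_def)
  then show ?thesis
    unfolding contains_negative_C4_def by (intro exI[of _ "[p, q, r, t]"]) simp
qed

text \<open>Lets a product over the set \<open>cycle_edges c\<close> be taken over positions. For
  length 2 both positions would give the same edge.\<close>

lemma inj_on_cycle_edges:
  assumes "distinct c" "3 \<le> length c"
  shows "inj_on (\<lambda>i. {c ! i, c ! (Suc i mod length c)}) {..<length c}"
proof (rule inj_onI)
  fix i j
  assume ij: "i \<in> {..<length c}" "j \<in> {..<length c}"
    and eq: "{c ! i, c ! (Suc i mod length c)} = {c ! j, c ! (Suc j mod length c)}"
  let ?n = "length c"
  have "?n > 0" using assms by linarith
  then have m: "Suc i mod ?n < ?n" "Suc j mod ?n < ?n" by auto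
  from eq consider "c ! i = c ! j"
    | "c ! i = c ! (Suc j mod ?n)" "c ! (Suc i mod ?n) = c ! j"
    by (auto simp: doubleton_eq_iff)
  then show "i = j"
  proof cases
    case 1
    then show ?thesis using assms ij by (simp add: nth_eq_iff_index_eq)
  next
    case 2
    then have "i = Suc j mod ?n" "Suc i mod ?n = j"
      using assms ij m by (simp_all add: nth_eq_iff_index_eq)
    then show ?thesis using ij assms
      by (auto simp: mod_Suc split: if_splits)
  qed
qed

text \<open>Each vertex of a cycle lies on two of its edges, so its sign occurs squared in the
  product of the edge signs.\<close>

lemma balanced_I:
  assumes \<Gamma>: "signed_graph \<Gamma>"
    and s: "\<And>v. s v = 1 \<or> s v = (-1::real)"
    and adj: "\<And>p q. {p, q} \<in> edges \<Gamma> \<Longrightarrow> adj \<Gamma> p q = s p * s q"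
  shows "balanced \<Gamma>"
  unfolding balanced_def
proof (intro allI impI)
  fix c assume c: "is_cycle \<Gamma> c"
  let ?n = "length c"
  let ?e = "\<lambda>i. {c ! i, c ! (Suc i mod ?n)}"
  have n: "3 \<le> ?n" and d: "distinct c" and sub: "cycle_edges c \<subseteq> edges \<Gamma>"
    using c by (auto simp: is_cycle_def)
  have ce: "cycle_edges c = ?e ` {..<?n}" by (rule cycle_edges_image)
  have rot: "bij_betw (\<lambda>i. Suc i mod ?n) {..<?n} {..<?n}"
  proof -
    have inj: "inj_on (\<lambda>i. Suc i mod ?n) {..<?n}"
      by (auto simp: inj_on_def mod_Suc split: if_splits)
    have "?n > 0" using n by linarith
    then have "(\<lambda>i. Suc i mod ?n) ` {..<?n} \<subseteq> {..<?n}" by auto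
    then have "(\<lambda>i. Suc i mod ?n) ` {..<?n} = {..<?n}"
      by (intro card_subset_eq) (simp_all add: card_image[OF inj])
    with inj show ?thesis by (simp add: bij_betw_def)
  qed
  have "(\<Prod>e\<in>cycle_edges c. real_of_int (edge_sign \<Gamma> e)) = (\<Prod>i<?n. real_of_int (edge_sign \<Gamma> (?e i)))"
    unfolding ce by (rule prod.reindex_cong[OF inj_on_cycle_edges[OF d n]]) auto
  also have "\<dots> = (\<Prod>i<?n. s (c ! i) * s (c ! (Suc i mod ?n)))"
  proof (rule prod.cong[OF refl])
    fix i assume "i \<in> {..<?n}"
    then have "?e i \<in> edges \<Gamma>" using sub ce by auto
    then show "real_of_int (edge_sign \<Gamma> (?e i)) = s (c ! i) * s (c ! (Suc i mod ?n))"
      using adj[of "c ! i" "c ! (Suc i mod ?n)"] by (simp add: adj_def)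
  qed
  also have "\<dots> = (\<Prod>i<?n. s (c ! i)) * (\<Prod>i<?n. s (c ! i))"
    using prod.reindex_bij_betw[OF rot, of "\<lambda>i. s (c ! i)"] by (simp add: prod.distrib)
  also have "\<dots> = (\<Prod>i<?n. s (c ! i) * s (c ! i))" by (simp add: prod.distrib)
  also have "\<dots> = 1"
  proof (rule prod.neutral, rule ballI)
    fix i show "s (c ! i) * s (c ! i) = 1" using s[of "c ! i"] by auto
  qed
  finally have one: "(\<Prod>e\<in>cycle_edges c. real_of_int (edge_sign \<Gamma> e)) = 1" .
  have "even (card {e \<in> cycle_edges c. edge_sign \<Gamma> e = -1})"
    using one prod_edge_sign[OF \<Gamma> _ sub] by (simp add: ce minus_one_power_iff split: if_splits)
  with c show "positive_cycle \<Gamma> c" by (simp add: positive_cycle_def)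
qed

lemma isomorphic_I:
  assumes \<Gamma>: "signed_graph \<Gamma>" and \<Delta>: "signed_graph \<Delta>"
    and f: "bij_betw f (verts \<Gamma>) (verts \<Delta>)"
    and adj: "\<And>p q. p \<in> verts \<Gamma> \<Longrightarrow> q \<in> verts \<Gamma> \<Longrightarrow> adj \<Gamma> p q = adj \<Delta> (f p) (f q)"
  shows "isomorphic \<Gamma> \<Delta>"
proof -
  have im: "f ` e \<in> edges \<Delta> \<and> edge_sign \<Delta> (f ` e) = edge_sign \<Gamma> e" if "e \<in> edges \<Gamma>" for e
  proof -
    obtain p q where e: "e = {p, q}" and pq: "p \<in> verts \<Gamma>" "q \<in> verts \<Gamma>"
      by (rule signed_graph_edgeE[OF \<Gamma> \<open>e \<in> edges \<Gamma>\<close>])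
    have "{f p, f q} \<in> edges \<Delta>"
      using that adj[OF pq] adj_eq_0_iff[OF \<Gamma>] adj_eq_0_iff[OF \<Delta>] unfolding e by metis
    with that adj[OF pq] show ?thesis by (simp add: adj_def e)
  qed
  have "edges \<Delta> \<subseteq> (`) f ` edges \<Gamma>"
  proof
    fix e assume e: "e \<in> edges \<Delta>"
    obtain p' q' where e': "e = {p', q'}" "p' \<in> verts \<Delta>" "q' \<in> verts \<Delta>"
      by (rule signed_graph_edgeE[OF \<Delta> e])
    obtain p q where pq: "p \<in> verts \<Gamma>" "q \<in> verts \<Gamma>" and f': "p' = f p" "q' = f q"
      using e'(2,3) unfolding bij_betw_imp_surj_on[OF f, symmetric] by blast
    have "{p, q} \<in> edges \<Gamma>"
      using e adj[OF pq] adj_eq_0_iff[OF \<Gamma>] adj_eq_0_iff[OF \<Delta>] unfolding e'(1) f' by metis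
    moreover have "e = f ` {p, q}" by (simp add: e'(1) f')
    ultimately show "e \<in> (`) f ` edges \<Gamma>" by blast
  qed
  with f im show ?thesis unfolding isomorphic_def by blast
qed

section \<open>Switching as diagonal conjugation\<close>

text \<open>The diagonal of the matrix by which switching at \<open>U\<close> conjugates the
  adjacency matrix.\<close>

definition switching_sign :: "'a set \<Rightarrow> 'a \<Rightarrow> real" where
  "switching_sign U v = (if v \<in> U then -1 else 1)"

lemma signed_graph_switch: "signed_graph \<Gamma> \<Longrightarrow> signed_graph (switch U \<Gamma>)"
  by (auto simp: signed_graph_def switch_def)

lemma adj_switch:
  assumes "p \<in> verts \<Gamma>" "q \<in> verts \<Gamma>"
  shows "adj (switch U \<Gamma>) p q = switching_sign U p * switching_sign U q * adj \<Gamma> p q"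
  using assms by (auto simp: adj_def switch_def switching_sign_def)

section \<open>A positive eigenvector of \<open>Gamma1\<close>\<close>

text \<open>The entries of the adjacency matrix of \<open>\<Gamma>\<^sub>1\<close> on an arbitrary vertex set, with \<open>a\<close>, \<open>b\<close>, \<open>u\<close>
  in the roles of \<open>v\<^sub>1\<close>, \<open>v\<^sub>2\<close>, \<open>v\<^sub>3\<close>.\<close>

definition gamma1_entry :: "'a \<Rightarrow> 'a \<Rightarrow> 'a \<Rightarrow> 'a \<Rightarrow> 'a \<Rightarrow> real" where
  "gamma1_entry a b u p q =
     (if p = q then 0
      else if {p, q} = {a, b} then -1
      else if p \<in> {a, b} \<and> q \<noteq> u \<or> q \<in> {a, b} \<and> p \<noteq> u then 0
      else 1)"

lemma gamma1_entry_commute: "gamma1_entry a b u p q = gamma1_entry a b u q p"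
  by (auto simp: gamma1_entry_def insert_commute)

text \<open>The cubic is the condition for the vector \<open>gamma1_vector\<close> below, constant on \<open>{v\<^sub>1, v\<^sub>2}\<close> and on
  \<open>{v\<^sub>4, \<dots>, v\<^sub>n}\<close>, to be an eigenvector of \<open>\<Gamma>\<^sub>1\<close>. Every eigenvalue of \<open>\<Gamma>\<^sub>1\<close> is a lower bound of its
  index, so it is not necessary to know that this root is the largest one.\<close>

definition gamma1_eigenvalue :: "nat \<Rightarrow> real \<Rightarrow> bool" where
  "gamma1_eigenvalue n L \<longleftrightarrow> real n - 3 < L \<and>
     L * (L + 1) * (L - real n + 4) = 2 * (L - real n + 4) + (real n - 3) * (L + 1)"

lemma gamma1_eigenvalue_exists:
  assumes "n \<ge> 5"
  shows "\<exists>L. gamma1_eigenvalue n L"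
proof -
  define m where "m = real n"
  have m: "m \<ge> 5" using assms by (simp add: m_def)
  \<comment> \<open>The difference of the two sides of the cubic, negative at \<open>m - 3\<close>
    and nonnegative at \<open>m - 2\<close>.\<close>
  define g where "g L = L * (L + 1) * (L - m + 4) - 2 * (L - m + 4) - (m - 3) * (L + 1)" for L
  have g0: "g (m - 3) = -2" by (simp add: g_def algebra_simps)
  have "g (m - 2) = (m - 1)\<^sup>2 - 4" by (simp add: g_def algebra_simps power2_eq_square)
  moreover have "4\<^sup>2 \<le> (m - 1)\<^sup>2" using m by (intro power_mono) auto
  ultimately have g1: "0 \<le> g (m - 2)" by simp
  have "\<exists>L\<ge>m - 3. L \<le> m - 2 \<and> g L = 0"
    using g0 g1 by (intro IVT') (auto simp: g_def intro!: continuous_intros)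
  then obtain L where L: "m - 3 \<le> L" "g L = 0" by blast
  then have "m - 3 < L" using g0 by (cases "L = m - 3") auto
  with L show ?thesis unfolding gamma1_eigenvalue_def g_def m_def by (intro exI[of _ L]) auto
qed

text \<open>Contradicts the strict bound in \<open>negative_edge_dominates\<close>. For
  \<open>n \<ge> 6\<close> the factors exceed 1 and 4; for \<open>n = 5\<close> the cubic reads
  \<open>L * (L + 1) * (L - 1) = 4 * L\<close> and the bound is attained.\<close>

lemma gamma1_eigenvalue_ge:
  assumes "n \<ge> 5" and L: "gamma1_eigenvalue n L"
  shows "4 \<le> (L - real n + 4) * (L + 1)"
proof (cases "n = 5")
  case True
  have "L > 2" using L True by (simp add: gamma1_eigenvalue_def)
  moreover have "L = 0 \<or> (L + 1) * (L - 1) = 4"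
    using L True by (auto simp: gamma1_eigenvalue_def)
  ultimately show ?thesis using True by (auto simp: mult.commute)
next
  case False
  then have "L > 3" "L - real n + 4 > 1" using assms by (auto simp: gamma1_eigenvalue_def)
  then have "1 * 4 \<le> (L - real n + 4) * (L + 1)" by (intro mult_mono) auto
  then show ?thesis by simp
qed

text \<open>With the value 1 at \<open>u\<close>, the other two values solve the rows of
  \<open>a\<close>, \<open>b\<close> and of the remaining vertices: \<open>L * y = 1 - y\<close> and
  \<open>L * y = 1 + (n - 4) * y\<close>.\<close>

definition gamma1_vector :: "nat \<Rightarrow> real \<Rightarrow> 'a \<Rightarrow> 'a \<Rightarrow> 'a \<Rightarrow> 'a \<Rightarrow> real" where
  "gamma1_vector n L a b u v =
     (if v = u then 1 else if v = a \<or> v = b then 1 / (L + 1) else 1 / (L - real n + 4))"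

lemma gamma1_vector_pos: "gamma1_eigenvalue n L \<Longrightarrow> n \<ge> 5 \<Longrightarrow> gamma1_vector n L a b u v > 0"
  by (auto simp: gamma1_vector_def gamma1_eigenvalue_def)

text \<open>The row of \<open>u\<close> is the cubic divided by
  \<open>(L + 1) * (L - n + 4)\<close>; the other rows hold by the choice of the values. The vertex
  set is arbitrary so that the vector can also be used on the vertices of \<Gamma>.\<close>

lemma gamma1_vector_eigen:
  assumes V: "finite V" "card V = n" and n: "n \<ge> 5" and L: "gamma1_eigenvalue n L"
    and abu: "{a, b, u} \<subseteq> V" "a \<noteq> b" "a \<noteq> u" "b \<noteq> u" and p: "p \<in> V"
  shows "(\<Sum>q\<in>V. gamma1_entry a b u p q * gamma1_vector n L a b u q) = L * gamma1_vector n L a b u p"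
proof -
  let ?y = "gamma1_vector n L a b u" and ?g = "gamma1_entry a b u"
  let ?c = "L - real n + 4"
  define W where "W = V - {a, b, u}"
  have VW: "V = insert a (insert b (insert u W))" and W: "finite W" "a \<notin> W" "b \<notin> W" "u \<notin> W"
    using abu V by (auto simp: W_def)
  have cW: "real (card W) = real n - 3"
    using V n abu by (simp add: W_def card_Diff_subset)
  have split: "(\<Sum>q\<in>V. ?g p q * ?y q) =
      ?g p a * ?y a + (?g p b * ?y b + (?g p u * ?y u + (\<Sum>q\<in>W. ?g p q * ?y q)))"
    unfolding VW using W abu by simp
  have Ln: "L > 2" "?c > 1" using L n by (auto simp: gamma1_eigenvalue_def)
  have yW: "?y q = 1 / ?c" if "q \<in> W" for q using that by (auto simp: W_def gamma1_vector_def)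
  consider "p = a" | "p = b" | "p = u" | "p \<in> W" using p VW by blast
  then show ?thesis
  proof cases
    case 1
    have "(\<Sum>q\<in>W. ?g p q * ?y q) = 0"
      using 1 W abu by (intro sum.neutral) (auto simp: W_def gamma1_entry_def doubleton_eq_iff)
    then show ?thesis unfolding split using 1 abu Ln
      by (simp add: gamma1_entry_def gamma1_vector_def doubleton_eq_iff field_simps)
  next
    case 2
    have "(\<Sum>q\<in>W. ?g p q * ?y q) = 0"
      using 2 W abu by (intro sum.neutral) (auto simp: W_def gamma1_entry_def doubleton_eq_iff)
    then show ?thesis unfolding split using 2 abu Ln
      by (simp add: gamma1_entry_def gamma1_vector_def doubleton_eq_iff field_simps)
  next
    case 3
    have "(\<Sum>q\<in>W. ?g p q * ?y q) = (\<Sum>q\<in>W. 1 / ?c)"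
      using 3 W abu yW by (intro sum.cong) (auto simp: W_def gamma1_entry_def doubleton_eq_iff)
    then have sW: "(\<Sum>q\<in>W. ?g p q * ?y q) = (real n - 3) / ?c" using cW by simp
    have "L * (L + 1) * ?c = 2 * ?c + (real n - 3) * (L + 1)"
      using L by (simp add: gamma1_eigenvalue_def)
    then have "L = 2 / (L + 1) + (real n - 3) / ?c"
      using Ln by (simp add: divide_simps)
    then show ?thesis unfolding split sW using 3 abu
      by (simp add: gamma1_entry_def gamma1_vector_def doubleton_eq_iff)
  next
    case 4
    then have ne: "p \<noteq> a" "p \<noteq> b" "p \<noteq> u" using W by auto
    have "(\<Sum>q\<in>W. ?g p q * ?y q) = (\<Sum>q\<in>W - {p}. ?g p q * ?y q)"
      using W by (intro sum.mono_neutral_right) (auto simp: gamma1_entry_def)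
    also have "\<dots> = (\<Sum>q\<in>W - {p}. 1 / ?c)"
      using 4 abu yW by (intro sum.cong) (auto simp: W_def gamma1_entry_def doubleton_eq_iff)
    also have "\<dots> = (real n - 4) / ?c"
      using W 4 cW n by (simp add: card_gt_0_iff of_nat_diff Suc_leI)
    finally have sW: "(\<Sum>q\<in>W. ?g p q * ?y q) = (real n - 4) / ?c" .
    have "?g p a = 0" "?g p b = 0" "?g p u = 1" "?y u = 1" "?y p = 1 / ?c"
      using ne abu by (auto simp: gamma1_entry_def gamma1_vector_def doubleton_eq_iff)
    then show ?thesis unfolding split sW using Ln by (simp add: divide_simps)
  qed
qed

lemma signed_graph_Gamma1: "n \<ge> 3 \<Longrightarrow> signed_graph (Gamma1 n)"
  by (auto simp: signed_graph_def Gamma1_def)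

lemma adj_Gamma1:
  assumes "n \<ge> 5" "p \<in> {1..n}" "q \<in> {1..n}"
  shows "adj (Gamma1 n) p q = gamma1_entry 1 2 3 p q"
proof -
  have "{p, q} \<in> {{i, j} | i j. 3 \<le> i \<and> i < j \<and> j \<le> n} \<longleftrightarrow> p \<noteq> q \<and> 3 \<le> p \<and> 3 \<le> q" (is "?L \<longleftrightarrow> ?R")
  proof
    assume ?L
    then show ?R by (auto simp: doubleton_eq_iff)
  next
    assume R: ?R
    then have "{p, q} = {min p q, max p q} \<and> 3 \<le> min p q \<and> min p q < max p q \<and> max p q \<le> n"
      using assms by (auto simp: min_def max_def)
    then show ?L by blast
  qed
  moreover have "edges (Gamma1 n) =
      {{i, j} | i j. 3 \<le> i \<and> i < j \<and> j \<le> n} \<union> {{1, 3}, {2, 3}, {1, 2}}"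
    by (simp add: Gamma1_def)
  ultimately have edge: "{p, q} \<in> edges (Gamma1 n) \<longleftrightarrow>
      p \<noteq> q \<and> 3 \<le> p \<and> 3 \<le> q \<or> {p, q} = {1, 3} \<or> {p, q} = {2, 3} \<or> {p, q} = {1, 2}"
    by (simp only: Un_iff insert_iff empty_iff simp_thms)
  have sign: "edge_sign (Gamma1 n) {p, q} = (if {p, q} = {1, 2} then -1 else 1)"
    by (simp add: Gamma1_def)
  have "p = 1 \<or> p = 2 \<or> p = 3 \<or> 4 \<le> p" "q = 1 \<or> q = 2 \<or> q = 3 \<or> 4 \<le> q"
    using assms by auto
  then show ?thesis
    unfolding adj_def gamma1_entry_def edge sign doubleton_eq_iff
    by (elim disjE) simp_all
qed

lemma gamma1_eigenvalue_le_index: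
  assumes n: "n \<ge> 5" and L: "gamma1_eigenvalue n L"
  shows "L \<le> index (Gamma1 n)"
proof -
  have v: "verts (Gamma1 n) = {1..n}" by (simp add: Gamma1_def)
  have "L \<in> graph_eigenvalues (Gamma1 n)"
    unfolding graph_eigenvalues_iff[of "Gamma1 n", unfolded v, OF finite_atLeastAtMost] v
  proof (intro exI[of _ "gamma1_vector n L 1 2 3"] conjI ballI)
    show "\<exists>w\<in>{1..n}. gamma1_vector n L 1 2 3 w \<noteq> 0"
      using n by (intro bexI[of _ 3]) (auto simp: gamma1_vector_def)
    fix p assume p: "p \<in> {1..n}"
    have "(\<Sum>q\<in>{1..n}. adj (Gamma1 n) p q * gamma1_vector n L 1 2 3 q) =
        (\<Sum>q\<in>{1..n}. gamma1_entry 1 2 3 p q * gamma1_vector n L 1 2 3 q)"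
      using adj_Gamma1[OF n p] by (intro sum.cong) auto
    also have "\<dots> = L * gamma1_vector n L 1 2 3 p"
      using n p L by (intro gamma1_vector_eigen) auto
    finally show "(\<Sum>q\<in>{1..n}. adj (Gamma1 n) p q * gamma1_vector n L 1 2 3 q) =
        L * gamma1_vector n L 1 2 3 p" .
  qed
  then show ?thesis
    unfolding index_def using n by (intro Max_ge finite_graph_eigenvalues signed_graph_Gamma1) auto
qed

section \<open>Structure around a vertex with maximal eigenvector entry\<close>

text \<open>The matrix \<open>w\<close> is the adjacency matrix of \<open>\<Gamma>\<close> after switching.\<close>

locale nonneg_eigenvector =
  fixes V :: "'a set" and n :: nat and w :: "'a \<Rightarrow> 'a \<Rightarrow> real" and x :: "'a \<Rightarrow> real"
    and k :: real and u :: 'a and P :: "'a set"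
  assumes finite_V: "finite V" and card_V: "card V = n" and n_ge_5: "n \<ge> 5"
    and w_commute: "w p q = w q p"
    and w_range: "w p q \<in> {-1, 0, 1}"
    and w_self: "w p p = 0"
    and no_negative_C4: "{p, q, r, t} \<subseteq> V \<Longrightarrow> distinct [p, q, r, t] \<Longrightarrow>
      w p q * w q r * w r t * w t p \<noteq> -1"
    and eigen: "p \<in> V \<Longrightarrow> (\<Sum>q\<in>V. w p q * x q) = k * x p"
    and x_nonneg: "p \<in> V \<Longrightarrow> 0 \<le> x p"
    and x_le_1: "p \<in> V \<Longrightarrow> x p \<le> 1"
    and u_in_V: "u \<in> V" and x_u: "x u = 1"
    and k_gt: "real n - 3 < k"
    and P_def: "P = {q \<in> V. w u q = 1}"
begin

lemma P_subset: "P \<subseteq> V" and u_notin_P: "u \<notin> P" and finite_P: "finite P"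
  using w_self finite_V by (auto simp: P_def)

lemma w_u_P: "p \<in> P \<Longrightarrow> w u p = 1" "p \<in> P \<Longrightarrow> w p u = 1"
  using w_commute by (auto simp: P_def)

lemma w_u_outside: "z \<in> V \<Longrightarrow> z \<notin> P \<Longrightarrow> w u z = 0 \<or> w u z = -1"
  using w_range[of u z] by (auto simp: P_def)

lemma k_gt_2: "k > 2"
  using k_gt n_ge_5 by linarith

text \<open>In the row of \<open>u\<close> a positive neighbour contributes at most 1 and any other
  vertex at most 0, so the integer \<open>card P\<close> is at least
  \<open>k > n - 3\<close>.\<close>

lemma card_P: "n \<le> card P + 2"
proof -
  have "k = (\<Sum>q\<in>V. w u q * x q)" using eigen[OF u_in_V] x_u by simp
  also have "\<dots> \<le> (\<Sum>q\<in>V. if q \<in> P then 1 else 0)"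
  proof (rule sum_mono)
    fix q assume "q \<in> V"
    then show "w u q * x q \<le> (if q \<in> P then 1 else 0)"
      using w_range[of u q] x_nonneg[of q] x_le_1[of q] by (auto simp: P_def)
  qed
  also have "\<dots> = card P"
    using finite_V P_subset by (simp add: sum.If_cases Int_absorb1)
  finally show ?thesis using k_gt by linarith
qed

text \<open>\<open>u\<close> and \<open>P\<close> make up at least \<open>n - 1\<close> of the
  \<open>n\<close> vertices.\<close>

lemma V_cases:
  obtains "V = insert u P"
  | z where "z \<noteq> u" "z \<notin> P" "V = insert u (insert z P)" "card P = n - 2"
proof (cases "V = insert u P")
  case False
  then obtain z where z: "z \<in> V" "z \<noteq> u" "z \<notin> P" using P_subset u_in_V by blast
  have "insert u (insert z P) \<subseteq> V" using z P_subset u_in_V by blast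
  moreover have c: "card (insert u (insert z P)) = card P + 2"
    using z u_notin_P finite_P by simp
  ultimately have "card P + 2 \<le> n" using card_mono[OF finite_V] card_V by metis
  then have "card P + 2 = n" using card_P by simp
  then have "insert u (insert z P) = V"
    using c card_V \<open>insert u (insert z P) \<subseteq> V\<close> finite_V by (intro card_subset_eq) auto
  with z \<open>card P + 2 = n\<close> that(2)[of z] show ?thesis by simp
qed (rule that(1))

lemma sum_V_split:
  assumes "z \<noteq> u" "z \<notin> P" "V = insert u (insert z P)"
  shows "(\<Sum>q\<in>V. f q) = f u + (f z + (\<Sum>q\<in>P. f q))"
  using assms u_notin_P finite_P by simp

section \<open>A negative edge among the positive neighbours\<close>

text \<open>A negative edge from \<open>r\<close> to \<open>p\<close> and a positive edge from
  \<open>p\<close> to \<open>q\<close> would close through \<open>u\<close> to the negative 4-cycle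
  \<open>u r p q\<close>.\<close>

lemma negative_edge_isolated:
  assumes ab: "a \<in> P" "b \<in> P" "w a b = -1" and q: "q \<in> P"
  shows "w a q \<le> 0" "w b q \<le> 0"
proof -
  have ne: "w p q \<noteq> 1" if pr: "p \<in> P" "r \<in> P" "w r p = -1" for p r
  proof
    assume 1: "w p q = 1"
    then have "p \<noteq> q" "r \<noteq> q" "p \<noteq> r" using w_self[of p] pr w_commute[of r p] by auto
    then have "w u r * w r p * w p q * w q u \<noteq> -1"
      using pr q P_subset u_in_V u_notin_P by (intro no_negative_C4) auto
    then show False using 1 w_u_P pr q by simp
  qed
  have "w b a = -1" using ab w_commute[of a b] by simp
  then show "w a q \<le> 0" "w b q \<le> 0"
    using ne[of a b] ne[of b a] ab w_range[of a q] w_range[of b q] by auto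
qed

lemma mult_w_le:
  assumes "q \<in> V"
  shows "w p q * x q \<le> x q" "w p q \<le> 0 \<Longrightarrow> w p q * x q \<le> 0"
  using x_nonneg[OF assms] w_range[of p q] by auto

text \<open>The rows of \<open>a\<close> and \<open>b\<close> give
  \<open>x a + x b \<le> 4 / (k + 1)\<close>, while in the row of \<open>u\<close> the vertices of
  \<open>P\<close> must supply at least \<open>k\<close>, and those other than \<open>a\<close> and
  \<open>b\<close>, \<open>n - 4\<close> in number, supply less than 1 each.\<close>

lemma negative_edge_dominates:
  assumes ab: "a \<in> P" "b \<in> P" "w a b = -1"
    and z: "z \<noteq> u" "z \<notin> P" "V = insert u (insert z P)" "card P = n - 2"
  shows "(k - real n + 4) * (k + 1) < 4"
proof -
  have V: "u \<in> V" "z \<in> V" "P \<subseteq> V" using z by auto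
  have abV: "a \<in> V" "b \<in> V" using ab V by auto
  have ba: "w b a = -1" using ab w_commute[of a b] by simp
  have a_ne_b: "a \<noteq> b" using ab w_self by auto
  \<comment> \<open>The 2 bounds the terms of \<open>u\<close> and \<open>z\<close>; within
    \<open>P\<close> all terms but that of \<open>r\<close> are dropped, being at most 0.\<close>
  have bound: "k * x p \<le> 2 - x r"
    if pr: "p \<in> P" "r \<in> P" "w p r = -1" and neg: "\<And>q. q \<in> P \<Longrightarrow> w p q \<le> 0" for p r
  proof -
    have "(\<Sum>q\<in>P. w p q * x q) = w p r * x r + (\<Sum>q\<in>P - {r}. w p q * x q)"
      by (rule sum.remove[OF finite_P pr(2)])
    also have "(\<Sum>q\<in>P - {r}. w p q * x q) \<le> 0"
      using neg mult_w_le(2)[of _ p] V by (intro sum_nonpos) auto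
    finally have "(\<Sum>q\<in>P. w p q * x q) \<le> - x r" using pr by simp
    moreover have "w p u * x u \<le> 1" using mult_w_le(1)[of u p] V x_u by simp
    moreover have "w p z * x z \<le> 1" using mult_w_le(1)[of z p] V x_le_1[of z] by simp
    moreover have "k * x p = w p u * x u + (w p z * x z + (\<Sum>q\<in>P. w p q * x q))"
      using eigen[of p] pr V sum_V_split[OF z(1-3), of "\<lambda>q. w p q * x q"] by auto
    ultimately show ?thesis by linarith
  qed
  have s: "(k + 1) * (x a + x b) \<le> 4"
    using bound[OF ab negative_edge_isolated(1)[OF ab]]
      bound[OF ab(2,1) ba negative_edge_isolated(2)[OF ab]]
    by (simp add: algebra_simps)
  define Q where "Q = P - {a, b}"
  have Q: "finite Q" "Q \<subseteq> P" using finite_P by (auto simp: Q_def)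
  have cQ: "card Q + 4 = n"
    using z(4) ab a_ne_b n_ge_5 by (simp add: Q_def card_Diff_subset)
  \<comment> \<open>The terms of \<open>a\<close>, \<open>b\<close> and \<open>q\<close> itself are
    at most 0, which leaves \<open>n - 5\<close> vertices of \<open>P\<close> besides
    \<open>u\<close> and \<open>z\<close>; hence \<open>k * x q \<le> n - 3 < k\<close>.\<close>
  have lt: "x q < 1" if q: "q \<in> Q" for q
  proof -
    have qP: "q \<in> P" "q \<noteq> a" "q \<noteq> b" using q by (auto simp: Q_def)
    have "w q a \<le> 0" "w q b \<le> 0"
      using negative_edge_isolated[OF ab qP(1)] w_commute by metis+
    then have ab0: "w q a * x a \<le> 0" "w q b * x b \<le> 0" using mult_w_le(2) abV by auto
    have Peq: "P = insert a (insert b Q)" using ab by (auto simp: Q_def)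
    have "(\<Sum>r\<in>P. w q r * x r) =
        w q a * x a + (w q b * x b + (w q q * x q + (\<Sum>r\<in>Q - {q}. w q r * x r)))"
    proof -
      have "a \<notin> Q" "b \<notin> Q" by (auto simp: Q_def)
      then have "(\<Sum>r\<in>P. w q r * x r) = w q a * x a + (w q b * x b + (\<Sum>r\<in>Q. w q r * x r))"
        by (subst Peq) (use a_ne_b Q in simp)
      also have "(\<Sum>r\<in>Q. w q r * x r) = w q q * x q + (\<Sum>r\<in>Q - {q}. w q r * x r)"
        by (rule sum.remove[OF Q(1) q])
      finally show ?thesis .
    qed
    also have "\<dots> \<le> (\<Sum>r\<in>Q - {q}. w q r * x r)" using ab0 w_self by simp
    also have "\<dots> \<le> (\<Sum>r\<in>Q - {q}. 1)"
    proof (rule sum_mono)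
      fix r assume "r \<in> Q - {q}"
      then have "r \<in> V" using Q V by auto
      then show "w q r * x r \<le> 1" using mult_w_le(1)[of r q] x_le_1[of r] by linarith
    qed
    also have "\<dots> = real n - 5" using q Q cQ n_ge_5 by (simp add: of_nat_diff flip: cQ)
    finally have "(\<Sum>r\<in>P. w q r * x r) \<le> real n - 5" .
    moreover have "w q u * x u \<le> 1" using mult_w_le(1)[of u q] V x_u by simp
    moreover have "w q z * x z \<le> 1" using mult_w_le(1)[of z q] V x_le_1[of z] by simp
    moreover have "k * x q = w q u * x u + (w q z * x z + (\<Sum>r\<in>P. w q r * x r))"
      using eigen[of q] qP V sum_V_split[OF z(1-3), of "\<lambda>r. w q r * x r"] by auto
    ultimately have "k * x q < k * 1" using k_gt by linarith
    then show ?thesis using k_gt_2 by simp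
  qed
  have "Q \<noteq> {}" using cQ n_ge_5 by auto
  then have "(\<Sum>q\<in>Q. x q) < (\<Sum>q\<in>Q. 1)" using Q lt by (intro sum_strict_mono) auto
  then have sQ: "(\<Sum>q\<in>Q. x q) < real n - 4" using cQ by simp
  have "k = w u u * x u + (w u z * x z + (\<Sum>q\<in>P. w u q * x q))"
    using eigen[OF u_in_V] x_u sum_V_split[OF z(1-3), of "\<lambda>q. w u q * x q"] by simp
  moreover have "w u z \<le> 0" using w_u_outside[OF V(2) z(2)] by auto
  ultimately have "k \<le> (\<Sum>q\<in>P. w u q * x q)" using mult_w_le(2)[of z u] V w_self by simp
  also have "\<dots> = (\<Sum>q\<in>P. x q)" using w_u_P by (intro sum.cong) auto
  also have "\<dots> = (\<Sum>q\<in>Q. x q) + (x a + x b)"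
  proof -
    have "P = insert a (insert b Q)" using ab by (auto simp: Q_def)
    moreover have "a \<notin> Q" "b \<notin> Q" by (auto simp: Q_def)
    ultimately show ?thesis using a_ne_b Q by simp
  qed
  finally have "k - real n + 4 < x a + x b" using sQ by linarith
  then have "(k - real n + 4) * (k + 1) < (x a + x b) * (k + 1)"
    using k_gt_2 by (intro mult_strict_right_mono) auto
  with s show ?thesis by (simp add: mult.commute)
qed

section \<open>No negative edge among the positive neighbours\<close>

text \<open>\<open>s\<close> is a switching that makes all edges positive: it is constant or singles
  out \<open>z\<close>. If \<open>z\<close> is joined to \<open>u\<close> negatively and to
  \<open>P\<close> positively, no such \<open>s\<close> is at hand, but then \<open>k\<close> is too
  small.\<close>

lemma no_negative_edge_imp_balanced:
  assumes pos: "\<And>p q. p \<in> P \<Longrightarrow> q \<in> P \<Longrightarrow> w p q \<noteq> -1"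
  shows "\<exists>s. (\<forall>v. s v = 1 \<or> s v = (-1::real)) \<and>
    (\<forall>p\<in>V. \<forall>q\<in>V. w p q \<noteq> 0 \<longrightarrow> w p q = s p * s q)"
proof (cases rule: V_cases)
  case 1
  have "w p q = 1" if "p \<in> V" "q \<in> V" "w p q \<noteq> 0" for p q
  proof -
    have "p = u \<or> p \<in> P" "q = u \<or> q \<in> P" using that 1 by auto
    then show ?thesis using that(3) pos[of p q] w_range[of p q] w_u_P w_self[of u] by auto
  qed
  then show ?thesis by (intro exI[of _ "\<lambda>_. 1"]) auto
next
  case (2 z)
  have V: "u \<in> V" "z \<in> V" "P \<subseteq> V" using 2 by auto
  have uz: "w u z = 0 \<or> w u z = -1" by (rule w_u_outside[OF V(2) 2(2)])
  \<comment> \<open>Otherwise \<open>u p z q\<close> is a negative 4-cycle. So all edges from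
    \<open>z\<close> into \<open>P\<close> have the same sign.\<close>
  have same: "w z p * w z q \<noteq> -1" if "p \<in> P" "q \<in> P" for p q
  proof (cases "p = q")
    case False
    then have "w u p * w p z * w z q * w q u \<noteq> -1"
      using that 2 V u_notin_P by (intro no_negative_C4) auto
    then show ?thesis using w_u_P that w_commute[of p z] by simp
  qed (use w_range[of z q] in auto)
  have PP: "w p q = 0 \<or> w p q = 1" if "p \<in> P" "q \<in> P" for p q
    using pos[OF that] w_range[of p q] by auto
  show ?thesis
  proof (cases "\<exists>v\<in>P. w z v = 1")
    case False
    then have zP: "w z p = 0 \<or> w z p = -1" if "p \<in> P" for p using that w_range[of z p] by auto
    have zP': "w p z = 0 \<or> w p z = -1" if "p \<in> P" for p using zP[OF that] w_commute[of p z] by simp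
    have zu: "w z u = 0 \<or> w z u = -1" using uz w_commute[of z u] by simp
    \<comment> \<open>The negative edges are exactly the edges at \<open>z\<close>.\<close>
    have "w p q = (if p = z then -1 else 1) * (if q = z then -1 else 1)"
      if "p \<in> V" "q \<in> V" "w p q \<noteq> 0" for p q
    proof -
      have "p = u \<or> p = z \<or> p \<in> P" "q = u \<or> q = z \<or> q \<in> P" using that 2 by auto
      then show ?thesis
        using that(3) 2 uz zu w_self zP[of q] zP'[of p] PP[of p q] w_u_P[of p] w_u_P[of q] by auto
    qed
    then show ?thesis by (intro exI[of _ "\<lambda>v. if v = z then -1 else 1"]) auto
  next
    case True
    then obtain v where v: "v \<in> P" "w z v = 1" by blast
    have zP: "w z p = 0 \<or> w z p = 1" if "p \<in> P" for p
      using same[OF that v(1)] v w_range[of z p] by auto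
    have zP': "w p z = 0 \<or> w p z = 1" if "p \<in> P" for p using zP[OF that] w_commute[of p z] by simp
    show ?thesis
    proof (cases "w u z = 0")
      case True
      then have "w z u = 0" using w_commute[of z u] by simp
      have "w p q = 1" if "p \<in> V" "q \<in> V" "w p q \<noteq> 0" for p q
      proof -
        have "p = u \<or> p = z \<or> p \<in> P" "q = u \<or> q = z \<or> q \<in> P" using that 2 by auto
        then show ?thesis
          using that(3) True \<open>w z u = 0\<close> w_self zP[of q] zP'[of p] PP[of p q] w_u_P[of p] w_u_P[of q]
          by auto
      qed
      then show ?thesis by (intro exI[of _ "\<lambda>_. 1"]) auto
    next
      case False
      then have uz: "w u z = -1" "w z u = -1" using uz w_commute[of z u] by auto
      define K where "K = {q \<in> P. w z q = 1}"
      have K: "K \<subseteq> P" "finite K" "v \<in> K" using finite_P v by (auto simp: K_def)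
      \<comment> \<open>Otherwise \<open>u z q p\<close> is a 4-cycle whose only negative edge joins
        \<open>u\<close> and \<open>z\<close>. Hence \<open>q\<close> has no neighbours but
        \<open>u\<close> and \<open>z\<close>.\<close>
      have isolated: "w q p = 0" if q: "q \<in> K" and p: "p \<in> P" for q p
      proof (rule ccontr)
        assume "w q p \<noteq> 0"
        then have 1: "w q p = 1" using PP[of q p] q p K by auto
        then have "q \<noteq> p" using w_self by auto
        then have "w u z * w z q * w q p * w p u \<noteq> -1"
          using q p K 2 V u_notin_P by (intro no_negative_C4) auto
        then show False using uz 1 q p w_u_P by (simp add: K_def)
      qed
      have xK: "k * x q = 1 + x z" if q: "q \<in> K" for q
      proof -
        have "(\<Sum>r\<in>P. w q r * x r) = 0" using isolated[OF q] by (intro sum.neutral) auto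
        moreover have "w q z = 1" using q w_commute[of q z] by (simp add: K_def)
        moreover have "w q u = 1" using q w_u_P by (simp add: K_def)
        ultimately show ?thesis
          using eigen[of q] q K V x_u sum_V_split[OF 2(1-3), of "\<lambda>r. w q r * x r"] by auto
      qed
      define S where "S = (\<Sum>q\<in>K. x q)"
      have kS: "k * S = real (card K) * (1 + x z)"
        using xK by (simp add: S_def sum_distrib_left)
      have "(\<Sum>q\<in>P. w z q * x q) = (\<Sum>q\<in>P. if q \<in> K then x q else 0)"
        using zP by (intro sum.cong) (auto simp: K_def)
      also have "\<dots> = S" using K finite_P by (simp add: S_def sum.If_cases Int_absorb1)
      finally have kz: "k * x z = -1 + S"
        using eigen[of z] V uz w_self x_u sum_V_split[OF 2(1-3), of "\<lambda>q. w z q * x q"] by simp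
      have z01: "0 \<le> x z" "x z \<le> 1" using V x_nonneg x_le_1 by auto
      have cK: "card K \<ge> 1" using K by (simp add: Suc_le_eq card_gt_0_iff) blast
      have "(\<Sum>q\<in>P - K. x q) \<le> (\<Sum>q\<in>P - K. 1)"
        using x_le_1 V by (intro sum_mono) auto
      also have "\<dots> = real n - 2 - real (card K)"
        using K finite_P 2(4) n_ge_5 card_mono[OF finite_P K(1)]
        by (simp add: card_Diff_subset of_nat_diff)
      finally have "(\<Sum>q\<in>P. x q) \<le> real n - 2 - real (card K) + S"
        using sum.subset_diff[OF K(1) finite_P, of x] by (simp add: S_def)
      moreover have "(\<Sum>q\<in>P. w u q * x q) = (\<Sum>q\<in>P. x q)"
        using w_u_P by (intro sum.cong) auto
      ultimately have kle: "k \<le> real n - 2 - real (card K) + S - x z"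
        using eigen[OF u_in_V] uz w_self x_u sum_V_split[OF 2(1-3), of "\<lambda>q. w u q * x q"] by simp
      have False
      proof (cases "card K = 1")
        \<comment> \<open>The row of \<open>z\<close> and \<open>x z \<ge> 0\<close> force
          \<open>S \<ge> 1\<close>, whereas \<open>k * S = 1 + x z \<le> 2 < k\<close>.\<close>
        case True
        then have "k * S = 1 + x z" using kS by simp
        moreover have "S \<ge> 1" using kz z01 k_gt_2 by (smt (verit) mult_nonneg_nonneg)
        then have "k * S \<ge> k * 1" using k_gt_2 by (intro mult_left_mono) auto
        ultimately show False using k_gt_2 z01 by simp
      next
        case False
        then have c2: "real (card K) \<ge> 2" using cK by linarith
        let ?c = "real (card K)"
        have S0: "0 \<le> S" unfolding S_def using K V x_nonneg by (intro sum_nonneg) auto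
        have "2 * S \<le> k * S" using k_gt_2 S0 by (intro mult_right_mono) auto
        then have "2 * S \<le> ?c * (1 + x z)" using kS by simp
        \<comment> \<open>The two sides differ by \<open>(?c - 2) * (1 - x z)\<close>. The resulting
          bound on \<open>S\<close> turns \<open>kle\<close> into
          \<open>k \<le> n - 3\<close>.\<close>
        moreover have "2 * (?c - 1) + 2 * x z \<ge> ?c * (1 + x z)"
        proof -
          have "0 \<le> (?c - 2) * (1 - x z)" using c2 z01 by (intro mult_nonneg_nonneg) auto
          then show ?thesis by (simp add: algebra_simps)
        qed
        ultimately have "2 * S \<le> 2 * (?c - 1) + 2 * x z" by (rule order_trans)
        then have "S \<le> ?c - 1 + x z" by simp
        with kle have "k \<le> real n - 3" by simp
        with k_gt show False by simp
      qed
      then show ?thesis ..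
    qed
  qed
qed

section \<open>Comparison with the matrix of \<open>Gamma1\<close>\<close>

text \<open>\<open>w\<close> is entrywise at most \<open>?g\<close>. Pairing \<open>?g - w\<close>
  with the positive \<open>?y\<close> and the nonnegative \<open>x\<close> gives
  \<open>(L - k) * ?N \<le> 0\<close>, so all terms vanish and the matrices agree in every column
  \<open>t\<close> with \<open>x t \<noteq> 0\<close>. Then \<open>x\<close> turns out to vanish
  nowhere.\<close>

lemma eq_gamma1_entry:
  assumes ab: "a \<in> P" "b \<in> P" "w a b = -1" and V: "V = insert u P"
    and L: "gamma1_eigenvalue n L" "L \<le> k"
    and pq: "p \<in> V" "q \<in> V"
  shows "w p q = gamma1_entry a b u p q"
proof -
  let ?g = "gamma1_entry a b u" and ?y = "gamma1_vector n L a b u"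
  have ne: "a \<noteq> b" "a \<noteq> u" "b \<noteq> u" using ab w_self u_notin_P by auto
  have ba: "w b a = -1" using ab w_commute[of a b] by simp
  have wab: "w a r \<le> 0" "w b r \<le> 0" "w r a \<le> 0" "w r b \<le> 0" if "r \<in> V" "r \<noteq> u" for r
    using that negative_edge_isolated[OF ab, of r] V w_commute[of r a] w_commute[of r b] by auto
  \<comment> \<open>The bounds \<open>wab\<close> serve the entries of \<open>a\<close> and
    \<open>b\<close> away from \<open>u\<close>; off the diagonal, \<open>?g\<close> is 1 everywhere
    else.\<close>
  have le: "w r t \<le> ?g r t" if "r \<in> V" "t \<in> V" for r t
    using that wab[of r] wab[of t] w_range[of r t] w_self ab ba
    by (auto simp: gamma1_entry_def doubleton_eq_iff)
  have y: "?y r > 0" for r using gamma1_vector_pos[OF L(1) n_ge_5] .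
  let ?D = "\<lambda>r t. ?y r * ((?g r t - w r t) * x t)"
  have D: "?D r t \<ge> 0" if "r \<in> V" "t \<in> V" for r t
    using le[OF that] x_nonneg that y[of r] by simp
  let ?N = "\<Sum>r\<in>V. ?y r * x r"
  have N: "?N \<ge> 0" using x_nonneg y by (intro sum_nonneg) (simp add: less_imp_le)
  have "(\<Sum>r\<in>V. \<Sum>t\<in>V. ?y r * (?g r t * x t)) = (\<Sum>t\<in>V. \<Sum>r\<in>V. ?y r * (?g r t * x t))"
    by (rule sum.swap)
  also have "\<dots> = (\<Sum>t\<in>V. (\<Sum>r\<in>V. ?g t r * ?y r) * x t)"
    by (simp add: sum_distrib_left mult_ac gamma1_entry_commute)
  also have "\<dots> = (\<Sum>t\<in>V. L * ?y t * x t)"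
    using gamma1_vector_eigen[OF finite_V card_V n_ge_5 L(1), of a b u] ne ab V
    by (intro sum.cong) auto
  finally have g: "(\<Sum>r\<in>V. \<Sum>t\<in>V. ?y r * (?g r t * x t)) = L * ?N"
    by (simp add: sum_distrib_left mult_ac)
  have "(\<Sum>r\<in>V. \<Sum>t\<in>V. ?y r * (w r t * x t)) = (\<Sum>r\<in>V. ?y r * (k * x r))"
    using eigen by (simp flip: sum_distrib_left)
  then have "(\<Sum>r\<in>V. \<Sum>t\<in>V. ?D r t) = L * ?N - k * ?N"
    using g by (simp add: left_diff_distrib right_diff_distrib sum_subtractf sum_distrib_left mult_ac)
  also have "\<dots> \<le> 0" using mult_right_mono[OF L(2) N] by simp
  finally have "(\<Sum>r\<in>V. \<Sum>t\<in>V. ?D r t) = 0"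
    using D by (intro antisym sum_nonneg) auto
  then have "?D r t = 0" if "r \<in> V" "t \<in> V" for r t
    using that D finite_V by (simp add: sum_nonneg_eq_0_iff sum_nonneg) blast
  then have eq: "w r t = ?g r t" if "r \<in> V" "t \<in> V" "x t \<noteq> 0" for r t
    using that y[of r] by force
  \<comment> \<open>Columns with \<open>x t = 0\<close> contribute to neither sum, so
    \<open>x\<close> is also an eigenvector of \<open>?g\<close> for \<open>k\<close>.\<close>
  have row: "(\<Sum>t\<in>V. ?g r t * x t) = k * x r" if "r \<in> V" for r
  proof -
    have "(\<Sum>t\<in>V. ?g r t * x t) = (\<Sum>t\<in>V. w r t * x t)"
    proof (rule sum.cong[OF refl])
      fix t assume "t \<in> V"
      then show "?g r t * x t = w r t * x t"
        by (cases "x t = 0") (simp_all add: eq[OF that])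
    qed
    with eigen[OF that] show ?thesis by simp
  qed
  have abV: "a \<in> V" "b \<in> V" "u \<in> V" using ab V by auto
  \<comment> \<open>The only nonzero entries in row \<open>c\<close> of \<open>?g\<close> are -1 at
    \<open>d\<close> and 1 at \<open>u\<close>.\<close>
  have pair: "k * x c + x d = 1" if cd: "c = a \<and> d = b \<or> c = b \<and> d = a" for c d
  proof -
    have "(\<Sum>t\<in>V. ?g c t * x t) = (\<Sum>t\<in>{d, u}. ?g c t * x t)"
      using abV finite_V cd ne
      by (intro sum.mono_neutral_right) (auto simp: gamma1_entry_def doubleton_eq_iff)
    also have "\<dots> = 1 - x d"
      using cd ne x_u by (auto simp: gamma1_entry_def doubleton_eq_iff)
    finally show ?thesis using row[of c] cd abV by auto
  qed
  have x_pos: "x r \<noteq> 0" if r: "r \<in> V" for r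
  proof (cases "r = u \<or> r = a \<or> r = b")
    case True
    \<comment> \<open>If one value were 0, the other would be 1, and the second equation would say
      \<open>k = 1\<close>.\<close>
    have "x a \<noteq> 0" "x b \<noteq> 0" using pair[of a b] pair[of b a] k_gt_2 by auto
    then show ?thesis using True x_u by auto
  next
    case False
    have "?g r u * x u \<le> (\<Sum>t\<in>V. ?g r t * x t)"
      using False finite_V abV x_nonneg
      by (intro member_le_sum[of u V "\<lambda>t. ?g r t * x t"]) (auto simp: gamma1_entry_def doubleton_eq_iff)
    moreover have "?g r u = 1" using False ne by (auto simp: gamma1_entry_def doubleton_eq_iff)
    ultimately show ?thesis using row[OF r] x_u by auto
  qed
  show ?thesis using eq[OF pq] x_pos[OF pq(2)] by simp
qed

end

section \<open>Switching to a nonnegative eigenvector and conclusion\<close>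

theorem theorem1:
  fixes n :: nat and \<Gamma> :: "'a signed_graph"
  assumes "n \<ge> 5"
    and "signed_graph \<Gamma>"
    and "card (verts \<Gamma>) = n"
    and "\<not> balanced \<Gamma>"
    and "index \<Gamma> \<ge> index (Gamma1 n)"
  shows "contains_negative_C4 \<Gamma> \<or> switching_equivalent_upto_iso \<Gamma> (Gamma1 n)"
proof (rule disjCI)
  assume no_iso: "\<not> switching_equivalent_upto_iso \<Gamma> (Gamma1 n)"
  show "contains_negative_C4 \<Gamma>"
  proof (rule ccontr)
    assume no_C4: "\<not> contains_negative_C4 \<Gamma>"
    note \<Gamma> = assms(2)
    define V where "V = verts \<Gamma>"
    define k where "k = index \<Gamma>"
    have V: "finite V" "card V = n" "V \<noteq> {}"
      using assms by (auto simp: V_def signed_graph_def)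
    have "k \<in> graph_eigenvalues \<Gamma>"
      unfolding k_def index_def using \<Gamma> V
      by (intro Max_in finite_graph_eigenvalues graph_eigenvalues_nonempty) (auto simp: V_def)
    then obtain x0 where x0: "\<exists>v\<in>V. x0 v \<noteq> 0"
      and eig: "\<And>p. p \<in> V \<Longrightarrow> (\<Sum>q\<in>V. adj \<Gamma> p q * x0 q) = k * x0 p"
      using V by (auto simp: graph_eigenvalues_iff V_def)
    define U where "U = {v \<in> V. x0 v < 0}"
    define s where "s = switching_sign U"
    have s: "s v = 1 \<or> s v = -1" for v by (simp add: s_def switching_sign_def)
    have ss: "s v * s v = 1" for v using s[of v] by auto
    have s_x0: "s v * \<bar>x0 v\<bar> = x0 v" "s v * x0 v = \<bar>x0 v\<bar>" if "v \<in> V" for v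
      using that by (auto simp: s_def switching_sign_def U_def)
    define w where "w p q = s p * s q * adj \<Gamma> p q" for p q
    have adj_w: "adj \<Gamma> p q = s p * s q * w p q" for p q
      using ss[of p] ss[of q] by (simp add: w_def mult_ac)
    define M where "M = Max ((\<lambda>v. \<bar>x0 v\<bar>) ` V)"
    have M: "\<bar>x0 v\<bar> \<le> M" if "v \<in> V" for v
      using that V by (auto simp: M_def)
    have M_pos: "M > 0" using x0 M by fastforce
    have "M \<in> (\<lambda>v. \<bar>x0 v\<bar>) ` V"
      unfolding M_def using V by (intro Max_in) auto
    then obtain u where u: "u \<in> V" "\<bar>x0 u\<bar> = M" by blast
    define x where "x v = \<bar>x0 v\<bar> / M" for v
    obtain L where L: "gamma1_eigenvalue n L"
      using gamma1_eigenvalue_exists[OF assms(1)] by blast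
    have L_le: "L \<le> k"
      using gamma1_eigenvalue_le_index[OF assms(1) L] assms(5) by (simp add: k_def)
    interpret nonneg_eigenvector V n w x k u "{q \<in> V. w u q = 1}"
    proof
      show "w p q = w q p" for p q by (simp add: w_def adj_commute mult_ac)
      show "w p q \<in> {-1, 0, 1}" for p q
        using adj_range[OF \<Gamma>, of p q] s[of p] s[of q] by (auto simp: w_def)
      show "w p p = 0" for p using adj_self[OF \<Gamma>] by (simp add: w_def)
      show "w p q * w q r * w r t * w t p \<noteq> -1" if "distinct [p, q, r, t]" for p q r t
      proof -
        have "w p q * w q r * w r t * w t p =
            (s p * s p) * (s q * s q) * (s r * s r) * (s t * s t) *
            (adj \<Gamma> p q * adj \<Gamma> q r * adj \<Gamma> r t * adj \<Gamma> t p)"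
          by (simp only: w_def mult_ac)
        then show ?thesis using negative_C4_I[OF \<Gamma> that] no_C4 ss by auto
      qed
      show "(\<Sum>q\<in>V. w p q * x q) = k * x p" if "p \<in> V" for p
      proof -
        have "(\<Sum>q\<in>V. w p q * x q) = (\<Sum>q\<in>V. s p / M * (adj \<Gamma> p q * (s q * \<bar>x0 q\<bar>)))"
          by (simp add: w_def x_def mult_ac)
        also have "\<dots> = s p / M * (\<Sum>q\<in>V. adj \<Gamma> p q * x0 q)"
          using s_x0(1) by (simp add: sum_distrib_left)
        also have "\<dots> = k * (s p * x0 p) / M" using eig[OF that] by simp
        finally show ?thesis using s_x0(2)[OF that] by (simp add: x_def)
      qed
      show "0 \<le> x p" "x p \<le> 1" if "p \<in> V" for p
        using M[OF that] M_pos by (auto simp: x_def)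
      show "x u = 1" using u M_pos by (simp add: x_def)
      show "real n - 3 < k" using L L_le by (simp add: gamma1_eigenvalue_def)
    qed (use V u assms(1) in auto)
    let ?P = "{q \<in> V. w u q = 1}"
    show False
    proof (cases "\<exists>a\<in>?P. \<exists>b\<in>?P. w a b = -1")
      case False
      then obtain s' where s': "\<And>v. s' v = 1 \<or> s' v = (-1::real)"
        and ws': "\<And>p q. p \<in> V \<Longrightarrow> q \<in> V \<Longrightarrow> w p q \<noteq> 0 \<Longrightarrow> w p q = s' p * s' q"
        using no_negative_edge_imp_balanced by blast
      have "balanced \<Gamma>"
      \<comment> \<open>\<open>s\<close> leads from \<Gamma> to \<open>w\<close>, and
        \<open>s'\<close> makes \<open>w\<close> nonnegative.\<close>
      proof (rule balanced_I[OF \<Gamma>, of "\<lambda>v. s v * s' v"])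
        show "s v * s' v = 1 \<or> s v * s' v = -1" for v using s[of v] s'[of v] by auto
        fix p q assume e: "{p, q} \<in> edges \<Gamma>"
        then have "{p, q} \<subseteq> V" using \<Gamma> unfolding signed_graph_def V_def by blast
        moreover have "w p q \<noteq> 0" using adj_eq_0_iff[OF \<Gamma>, of p q] e adj_w[of p q] by auto
        ultimately show "adj \<Gamma> p q = s p * s' p * (s q * s' q)"
          using ws'[of p q] adj_w[of p q] by (simp add: mult_ac)
      qed
      with assms(4) show False ..
    next
      case True
      then obtain a b where ab: "a \<in> ?P" "b \<in> ?P" "w a b = -1" by blast
      show False
      proof (cases rule: V_cases)
        case (2 z)
        have "(k - real n + 4) * (k + 1) < 4"
          by (rule negative_edge_dominates[OF ab 2])
        \<comment> \<open>Both factors are positive at \<open>L\<close> and grow with it, so the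
          bound at \<open>L\<close> carries over to \<open>k\<close>.\<close>
        moreover have "(L - real n + 4) * (L + 1) \<le> (k - real n + 4) * (k + 1)"
          using L L_le assms(1) by (intro mult_mono) (auto simp: gamma1_eigenvalue_def)
        ultimately show False using gamma1_eigenvalue_ge[OF assms(1) L] by linarith
      next
        case 1
        have ne: "a \<noteq> b" "a \<noteq> u" "b \<noteq> u" using ab w_self u_notin_P by auto
        have abu: "{a, b, u} \<subseteq> V" using ab u by auto
        have card_eq: "card (V - {a, b, u}) = card {4..n}"
          using V abu ne assms(1) by (simp add: card_Diff_subset)
        obtain h where h: "bij_betw h (V - {a, b, u}) {4..n}"
          using finite_same_card_bij[OF _ _ card_eq] V by auto
        \<comment> \<open>Any bijection \<open>h\<close> will do, as \<open>gamma1_entry\<close>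
          treats all vertices other than \<open>a\<close>, \<open>b\<close>, \<open>u\<close>
          alike.\<close>
        define f where "f v = (if v = a then 1 else if v = b then 2 else if v = u then 3 else h v)" for v
        have "bij_betw f ((V - {a, b, u}) \<union> {a, b, u}) ({4..n} \<union> {1, 2, 3})"
        proof (rule bij_betw_combine)
          show "bij_betw f (V - {a, b, u}) {4..n}"
            using h by (rule bij_betw_cong[THEN iffD1, rotated]) (auto simp: f_def)
          show "bij_betw f {a, b, u} {1, 2, 3}"
            using ne by (auto simp: bij_betw_def f_def)
        qed auto
        moreover have "(V - {a, b, u}) \<union> {a, b, u} = V" using abu by blast
        moreover have "{4..n} \<union> {1, 2, 3} = {1..n}" using assms(1) by auto
        ultimately have f: "bij_betw f V {1..n}" by simp
        have f_eq: "f p = f q \<longleftrightarrow> p = q" if "p \<in> V" "q \<in> V" for p q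
          using f that by (auto simp: bij_betw_def inj_on_def)
        have f_val: "f a = 1" "f b = 2" "f u = 3" using ne by (auto simp: f_def)
        have f_iff: "f p = 1 \<longleftrightarrow> p = a" "f p = 2 \<longleftrightarrow> p = b" "f p = 3 \<longleftrightarrow> p = u" if "p \<in> V" for p
          using f_eq[OF that] f_val abu by (metis insert_subset)+
        have vG: "verts (Gamma1 n) = {1..n}" "verts (switch U \<Gamma>) = V"
          by (simp_all add: Gamma1_def switch_def V_def)
        have "isomorphic (switch U \<Gamma>) (Gamma1 n)"
        proof (rule isomorphic_I)
          show "bij_betw f (verts (switch U \<Gamma>)) (verts (Gamma1 n))" using f vG by simp
          fix p q assume "p \<in> verts (switch U \<Gamma>)" "q \<in> verts (switch U \<Gamma>)"
          then have pq: "p \<in> V" "q \<in> V" using vG by auto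
          have fpq: "f p \<in> {1..n}" "f q \<in> {1..n}" using f pq by (auto simp: bij_betw_def)
          have "adj (switch U \<Gamma>) p q = w p q"
            using pq by (simp add: adj_switch V_def w_def s_def)
          also have "\<dots> = gamma1_entry a b u p q"
            by (rule eq_gamma1_entry[OF ab 1 L L_le pq])
          also have "\<dots> = gamma1_entry 1 2 3 (f p) (f q)"
            unfolding gamma1_entry_def doubleton_eq_iff
            using f_eq[OF pq] f_iff[OF pq(1)] f_iff[OF pq(2)] by simp blast
          also have "\<dots> = adj (Gamma1 n) (f p) (f q)"
            by (rule adj_Gamma1[OF assms(1) fpq, symmetric])
          finally show "adj (switch U \<Gamma>) p q = adj (Gamma1 n) (f p) (f q)" .
        qed (use \<Gamma> assms(1) in \<open>auto intro: signed_graph_switch signed_graph_Gamma1\<close>)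
        moreover have "switching_equivalent \<Gamma> (switch U \<Gamma>)"
          unfolding switching_equivalent_def
          by (intro r_into_rtranclp exI[of _ U]) (auto simp: U_def V_def)
        ultimately show False using no_iso unfolding switching_equivalent_upto_iso_def by blast
      qed
    qed
  qed
qed

end
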